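(* Let $\mathcal{O}_t, N_x, M_x, L$ be linear operators and $A=A(t)$ a function such that: (i) $\mathcal{O}_t$ satisfies the Leibniz rule with respect to the variable $t$, and $N_x$ and $M_x$ satisfy the Leibniz rule with respect to the variable $x$; (ii) $[\mathcal{O}_t,M_x]=[\mathcal{O}_t,N_x]=0$; (iii) $M_x=L N_x$; (iv) $\mathcal{O}_t A=-A^2$ and $A(t)\neq 0$ for each $t\neq 0$. Suppose there are an invertible function $g$ and a function $\psi=\psi(x,t)$ such that $u=\frac{1}{A(t)}N_x\,g^{-1}(\psi)$ is a solution of $$\mathcal{O}_t u-A(t)\,N_x\big(u\,L(u)\big)=N_xM_xu+A(t)\,u$$ and such that $$\mathcal{O}_t\psi=\psi\,\mathcal{O}_t\big(A(t)(N_x)^{-1}u\big),\qquad N_x\psi=\psi\,N_x\big(A(t)(N_x)^{-1}u\big),\qquad M_x\psi=\psi\,M_x\big(A(t)(N_x)^{-1}u\big).$$ Then $\psi$ is a solution of $$\mathcal{O}_t\psi=M_xN_x\psi,$$ and $\psi$ is written as $\psi(x,t)=g\big(A(t)(N_x)^{-1}u\big)$.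
   Context: All functions are real-valued functions of a space variable $x$ and a time variable $t$, regular enough that all expressions written are defined. $\mathcal{O}_t$ is a linear differential operator acting only on the variable $t$. $N_x$ and $M_x$ are linear differential operators acting only on the variable $x$, and $L$ is a linear operator acting only on the variable $x$; in particular these three commute with multiplication by functions of $t$ alone. An operator $D$ satisfies the Leibniz rule if $D(vw)=vD(w)+wD(v)$. $[P,Q]=PQ-QP$ is the commutator. $N_xM_x$ and $M_xN_x$ denote compositions. $(N_x)^{-1}$ denotes the inverse of $N_x$ on the functions under consideration, so that $N_x(N_x)^{-1}v=v$ (concretely, for a first-order operator $N_x=a(x)\partial_x$, the antiderivative $(N_x)^{-1}v=\int_{x_0}^{x}v(s,t)/a(s)\,ds$ from a fixed base point $x_0$). For a function $\xi(x,t)$, $g(\xi)$ denotes the composite function $(x,t)\mapsto g(\xi(x,t))$, and $g^{-1}$ is the inverse function of $g$; the model example is $g(\xi)=e^{\xi}$.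
   Formalization: The inverse of N_x is taken two-sided on a class of functions stable under O_t and multiplication by A, assumed to contain g^{-1}(ψ) and A u L(u)+M_x u; with only N_x(N_x)^{-1}v=v the claim fails, e.g. A=1/t, u=t, ψ=e^x, g=exp. *)

theory Defs
  imports "HOL-Analysis.Analysis"
begin

text \<open>Functions of \<open>(x, t)\<close> are curried, space variable first. They live on \<open>X \<times> T\<close>, with \<open>X\<close> and
  \<open>T\<close> open sets of reals, and are identified when they agree there.\<close>

type_synonym xt_fun = "real \<Rightarrow> real \<Rightarrow> real"
type_synonym xt_op = "xt_fun \<Rightarrow> xt_fun"

definition eq_on :: "real set \<Rightarrow> real set \<Rightarrow> xt_fun \<Rightarrow> xt_fun \<Rightarrow> bool" where
  "eq_on X T v w \<longleftrightarrow> (\<forall>x\<in>X. \<forall>t\<in>T. v x t = w x t)"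

definition function_space :: "xt_fun set \<Rightarrow> bool" where
  "function_space V \<longleftrightarrow> V \<noteq> {} \<and>
     (\<forall>v\<in>V. \<forall>w\<in>V. \<forall>c d. (\<lambda>x t. c * v x t + d * w x t) \<in> V)"

definition function_algebra :: "xt_fun set \<Rightarrow> bool" where
  "function_algebra F \<longleftrightarrow> function_space F \<and> (\<forall>v\<in>F. \<forall>w\<in>F. (\<lambda>x t. v x t * w x t) \<in> F)"

definition linear_op ::
  "real set \<Rightarrow> real set \<Rightarrow> xt_fun set \<Rightarrow> xt_fun set \<Rightarrow> xt_op \<Rightarrow> bool" where
  "linear_op X T V W D \<longleftrightarrow> (\<forall>v\<in>V. D v \<in> W) \<and>
     (\<forall>v\<in>V. \<forall>w\<in>V. \<forall>c d.
        eq_on X T (D (\<lambda>x t. c * v x t + d * w x t)) (\<lambda>x t. c * D v x t + d * D w x t))"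

text \<open>An operator acts only on \<open>x\<close> if the slice of \<open>D v\<close> at time \<open>t\<close> is determined by the slice of
  \<open>v\<close> at time \<open>t\<close>. For linear \<open>D\<close> this entails that \<open>D\<close> commutes with multiplication by functions
  of \<open>t\<close> alone: at time \<open>t\<close>, multiplication by \<open>a\<close> agrees with multiplication by the constant
  \<open>a t\<close>.\<close>

definition acts_on_x :: "real set \<Rightarrow> real set \<Rightarrow> xt_fun set \<Rightarrow> xt_op \<Rightarrow> bool" where
  "acts_on_x X T V D \<longleftrightarrow> (\<forall>v\<in>V. \<forall>w\<in>V. \<forall>t\<in>T.
     (\<forall>x\<in>X. v x t = w x t) \<longrightarrow> (\<forall>x\<in>X. D v x t = D w x t))"

definition acts_on_t :: "real set \<Rightarrow> real set \<Rightarrow> xt_fun set \<Rightarrow> xt_op \<Rightarrow> bool" where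
  "acts_on_t X T V D \<longleftrightarrow> (\<forall>v\<in>V. \<forall>w\<in>V. \<forall>x\<in>X.
     (\<forall>t\<in>T. v x t = w x t) \<longrightarrow> (\<forall>t\<in>T. D v x t = D w x t))"

text \<open>Differential operators of some finite order \<open>n\<close>, on functions regular enough for all
  derivatives in the formula to exist.\<close>

definition differential_op_x :: "real set \<Rightarrow> real set \<Rightarrow> xt_fun set \<Rightarrow> xt_op \<Rightarrow> bool" where
  "differential_op_x X T V D \<longleftrightarrow> (\<exists>(n::nat) (a :: nat \<Rightarrow> real \<Rightarrow> real). \<forall>v\<in>V. \<forall>x\<in>X. \<forall>t\<in>T.
     (\<forall>k<n. (deriv ^^ k) (\<lambda>s. v s t) differentiable (at x)) \<and>
     D v x t = (\<Sum>k\<le>n. a k x * (deriv ^^ k) (\<lambda>s. v s t) x))"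

definition differential_op_t :: "real set \<Rightarrow> real set \<Rightarrow> xt_fun set \<Rightarrow> xt_op \<Rightarrow> bool" where
  "differential_op_t X T V D \<longleftrightarrow> (\<exists>(n::nat) (a :: nat \<Rightarrow> real \<Rightarrow> real). \<forall>v\<in>V. \<forall>x\<in>X. \<forall>t\<in>T.
     (\<forall>k<n. (deriv ^^ k) (\<lambda>s. v x s) differentiable (at t)) \<and>
     D v x t = (\<Sum>k\<le>n. a k t * (deriv ^^ k) (\<lambda>s. v x s) t))"

definition leibniz :: "real set \<Rightarrow> real set \<Rightarrow> xt_fun set \<Rightarrow> xt_op \<Rightarrow> bool" where
  "leibniz X T V D \<longleftrightarrow> (\<forall>v\<in>V. \<forall>w\<in>V.
     eq_on X T (D (\<lambda>x t. v x t * w x t)) (\<lambda>x t. v x t * D w x t + w x t * D v x t))"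

definition commutator :: "xt_op \<Rightarrow> xt_op \<Rightarrow> xt_op" where
  "commutator P Q v = (\<lambda>x t. P (Q v) x t - Q (P v) x t)"

text \<open>A Leibniz operator annihilates constants, so \<open>N\<close> is invertible only on a class \<open>V\<close> of
  functions normalised in \<open>x\<close> (for instance vanishing at a base point, or decaying at
  \<open>-\<infinity>\<close>); \<open>W\<close> is the class of functions to which the inverse can be applied. Since the
  normalisation concerns \<open>x\<close> only, the inverse acts only on \<open>x\<close>.\<close>

definition inverse_op_x ::
  "real set \<Rightarrow> real set \<Rightarrow> xt_fun set \<Rightarrow> xt_fun set \<Rightarrow> xt_op \<Rightarrow> xt_op \<Rightarrow> bool" where
  "inverse_op_x X T V W N Ninv \<longleftrightarrow>
     (\<forall>v\<in>V. N v \<in> W) \<and> linear_op X T W V Ninv \<and> acts_on_x X T W Ninv \<and>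
     (\<forall>w\<in>W. eq_on X T (N (Ninv w)) w) \<and> (\<forall>v\<in>V. eq_on X T (Ninv (N v)) v)"

end

theory Submission
  imports Defs
begin

text \<open>Put \<open>\<theta> = Ninv u\<close>. Since \<open>N\<close> commutes with multiplication by functions of \<open>t\<close>, the relation
  between \<open>u\<close> and \<open>\<psi>\<close> reads \<open>N (inv g \<psi>) = N (A \<theta>)\<close> for \<open>t \<noteq> 0\<close>, and cancelling \<open>N\<close> gives
  \<open>\<psi> = g (A \<theta>)\<close> there; as functions in \<open>F\<close> are continuous in \<open>t\<close>, this extends to \<open>t = 0\<close>.
  Next, \<open>u = N \<theta>\<close> turns the equation for \<open>u\<close> into an identity between values of \<open>N\<close>, whence
  \<open>O \<theta> - A \<theta> = A u L u + M u\<close>. By the Leibniz rules \<open>O (A \<theta>) = A (O \<theta> - A \<theta>)\<close> and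
  \<open>M (N \<psi>) = \<psi> A (A u L u + M u)\<close>.\<close>

lemma eq_onD: "eq_on X T v w \<Longrightarrow> x \<in> X \<Longrightarrow> t \<in> T \<Longrightarrow> v x t = w x t"
  by (simp add: eq_on_def)

lemma function_space_diff:
  assumes "function_space V" "v \<in> V" "w \<in> V"
  shows "(\<lambda>x t. v x t - w x t) \<in> V"
proof -
  have "(\<lambda>x t. 1 * v x t + (- 1) * w x t) \<in> V"
    using assms unfolding function_space_def by blast
  then show ?thesis by simp
qed

lemma function_algebra_mult:
  "function_algebra F \<Longrightarrow> v \<in> F \<Longrightarrow> w \<in> F \<Longrightarrow> (\<lambda>x t. v x t * w x t) \<in> F"
  unfolding function_algebra_def by blast

lemma acts_on_x_cong:
  assumes "acts_on_x X T V D" "v \<in> V" "w \<in> V" "t \<in> T" "x \<in> X" "\<And>y. y \<in> X \<Longrightarrow> v y t = w y t"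
  shows "D v x t = D w x t"
  using assms unfolding acts_on_x_def by blast

lemma acts_on_t_cong:
  assumes "acts_on_t X T V D" "v \<in> V" "w \<in> V" "t \<in> T" "x \<in> X" "\<And>s. s \<in> T \<Longrightarrow> v x s = w x s"
  shows "D v x t = D w x t"
  using assms unfolding acts_on_t_def by blast

lemma linear_op_combine:
  assumes "linear_op X T V W D" "v \<in> V" "w \<in> V" "x \<in> X" "t \<in> T"
  shows "D (\<lambda>x t. c * v x t + d * w x t) x t = c * D v x t + d * D w x t"
  using assms unfolding linear_op_def eq_on_def by blast

lemma linear_op_diff:
  assumes "linear_op X T V W D" "v \<in> V" "w \<in> V" "x \<in> X" "t \<in> T"
  shows "D (\<lambda>x t. v x t - w x t) x t = D v x t - D w x t"
  using linear_op_combine[OF assms, of 1 "- 1"] by simp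

lemma linear_op_add:
  assumes "linear_op X T V W D" "v \<in> V" "w \<in> V" "x \<in> X" "t \<in> T"
  shows "D (\<lambda>x t. v x t + w x t) x t = D v x t + D w x t"
  using linear_op_combine[OF assms, of 1 1] by simp

text \<open>With \<open>t\<close> fixed, the slices of \<open>a * v\<close> and of the constant
  multiple \<open>a t * v\<close> coincide at time \<open>t\<close>, and \<open>D\<close> cannot
  distinguish them there. The summand \<open>0 * v y s\<close> only fits the shape in which
  linearity is stated.\<close>

lemma linear_op_x_mult_t:
  assumes "linear_op X T V W D" "acts_on_x X T V D" "function_space V"
    and "v \<in> V" "(\<lambda>x t. a t * v x t) \<in> V" and "x \<in> X" "t \<in> T"
  shows "D (\<lambda>x t. a t * v x t) x t = a t * D v x t"
proof -
  have "(\<lambda>y s. a t * v y s + 0 * v y s) \<in> V"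
    using assms(3,4) unfolding function_space_def by blast
  then have "D (\<lambda>x t. a t * v x t) x t = D (\<lambda>y s. a t * v y s + 0 * v y s) x t"
    using assms by (intro acts_on_x_cong[OF assms(2)]) auto
  then show ?thesis
    using linear_op_combine[OF assms(1,4,4,6,7), of "a t" 0] by simp
qed

lemma leibnizD:
  assumes "leibniz X T V D" "v \<in> V" "w \<in> V" "x \<in> X" "t \<in> T"
  shows "D (\<lambda>x t. v x t * w x t) x t = v x t * D w x t + w x t * D v x t"
  using assms unfolding leibniz_def eq_on_def by blast

text \<open>As \<open>Ninv\<close> acts only on \<open>x\<close>, injectivity of \<open>N\<close> on
  \<open>V\<close> holds one time slice at a time. Hence \<open>N\<close> can be cancelled at a
  single \<open>t\<close>, even if an equation is known only for
  \<open>t \<noteq> 0\<close>.\<close>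

lemma inverse_op_x_cancel:
  assumes "inverse_op_x X T V W N Ninv" "v \<in> V" "w \<in> V" "t \<in> T" "x \<in> X"
    and "\<And>y. y \<in> X \<Longrightarrow> N v y t = N w y t"
  shows "v x t = w x t"
proof -
  have "N v \<in> W" "N w \<in> W" and "acts_on_x X T W Ninv"
    and "Ninv (N v) x t = v x t" "Ninv (N w) x t = w x t"
    using assms(1-5) unfolding inverse_op_x_def eq_on_def by blast+
  then show ?thesis
    using acts_on_x_cong[of X T W Ninv "N v" "N w" t x] assms(4-6) by simp
qed

text \<open>An operator of order \<open>0\<close> obeying the Leibniz rule vanishes, so the order is positive and the
  functions in \<open>V\<close> are differentiable.\<close>

lemma leibniz_differential_op_t_differentiable:
  assumes "differential_op_t X T V D" "leibniz X T V D"
    and "v0 \<in> V" "(\<lambda>x t. v0 x t * v0 x t) \<in> V" "x0 \<in> X" "t0 \<in> T" "D v0 x0 t0 \<noteq> 0"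
    and "v \<in> V" "x \<in> X" "t \<in> T"
  shows "v x differentiable (at t)"
proof -
  obtain n :: nat and a where
    na: "\<And>v x t. v \<in> V \<Longrightarrow> x \<in> X \<Longrightarrow> t \<in> T \<Longrightarrow>
     (\<forall>k<n. (deriv ^^ k) (\<lambda>s. v x s) differentiable (at t)) \<and>
     D v x t = (\<Sum>k\<le>n. a k t * (deriv ^^ k) (\<lambda>s. v x s) t)"
    using assms(1) unfolding differential_op_t_def by blast
  have "n \<noteq> 0"
  proof
    assume "n = 0"
    then have D0: "D v x0 t0 = a 0 t0 * v x0 t0" if "v \<in> V" for v
      using na[OF that assms(5,6)] by simp
    \<comment> \<open>With order \<open>0\<close>, the Leibniz rule for \<open>v0 * v0\<close> reads
      \<open>a * v0 * v0 = 2 * a * v0 * v0\<close>, with \<open>a = a 0 t0\<close> and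
      \<open>v0\<close> taken at \<open>(x0, t0)\<close>.\<close>
    have "a 0 t0 * v0 x0 t0 * v0 x0 t0 = 0"
      using leibnizD[OF assms(2,3,3,5,6)] D0[OF assms(3)] D0[OF assms(4)] by simp
    then show False
      using D0[OF assms(3)] assms(7) by auto
  qed
  then show ?thesis
    using na[OF assms(8-10)] by (auto dest: spec[of _ 0])
qed

text \<open>Openness gives agreement on a punctured neighbourhood of \<open>a\<close>, so uniqueness
  of limits applies. This handles \<open>t = 0\<close>, where \<open>A\<close> may vanish.\<close>

lemma continuous_eq_at_point:
  fixes f h :: "real \<Rightarrow> real"
  assumes "isCont f a" "isCont h a" "open T" "a \<in> T" "\<And>t. t \<in> T \<Longrightarrow> t \<noteq> a \<Longrightarrow> f t = h t"
  shows "f a = h a"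
proof -
  have "\<forall>\<^sub>F t in at a. f t = h t"
    using assms(3-5) eventually_at_topological by blast
  then have "(h \<longlongrightarrow> f a) (at a)"
    using assms(1) tendsto_cong unfolding isCont_def by blast
  then show ?thesis
    using assms(2) tendsto_unique[OF trivial_limit_at] unfolding isCont_def by blast
qed

theorem proposition2p2:
  fixes X T S J :: "real set"
    and F V W :: "xt_fun set"
    and Ot Nx Mx L Ninv :: xt_op
    and A :: "real \<Rightarrow> real"
    and g :: "real \<Rightarrow> real"
    and u \<psi> :: xt_fun
  assumes "open X" and "open T"
    and "function_algebra F"
    and "linear_op X T F F Ot" and "acts_on_t X T F Ot" and "differential_op_t X T F Ot"
    and "linear_op X T F F Nx" and "acts_on_x X T F Nx" and "differential_op_x X T F Nx"
    and "linear_op X T F F Mx" and "acts_on_x X T F Mx" and "differential_op_x X T F Mx"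
    and "linear_op X T F F L" and "acts_on_x X T F L"
    and A_regular: "(\<lambda>x t. A t) \<in> F"
    and i: "leibniz X T F Ot" "leibniz X T F Nx" "leibniz X T F Mx"
    and ii: "\<forall>v\<in>F. eq_on X T (commutator Ot Mx v) (\<lambda>x t. 0)"
            "\<forall>v\<in>F. eq_on X T (commutator Ot Nx v) (\<lambda>x t. 0)"
    and iii: "\<forall>v\<in>F. eq_on X T (Mx v) (L (Nx v))"
    and iv: "eq_on X T (Ot (\<lambda>x t. A t)) (\<lambda>x t. - (A t)\<^sup>2)"
            "\<forall>t\<in>T. t \<noteq> 0 \<longrightarrow> A t \<noteq> 0"
    and V: "V \<subseteq> F" "function_space V" "\<forall>v\<in>V. Ot v \<in> V" "\<forall>v\<in>V. (\<lambda>x t. A t * v x t) \<in> V"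
    and W: "W \<subseteq> F" "function_space W"
    and Ninv: "inverse_op_x X T V W Nx Ninv"
    and g: "bij_betw g S J"
    and \<psi>: "\<psi> \<in> F" "\<forall>x\<in>X. \<forall>t\<in>T. \<psi> x t \<in> J" "(\<lambda>x t. inv_into S g (\<psi> x t)) \<in> V"
    and u: "u \<in> W" "(\<lambda>x t. A t * (u x t * L u x t) + Mx u x t) \<in> V"
    and u_eq: "eq_on X (T - {0}) u (\<lambda>x t. 1 / A t * Nx (\<lambda>x t. inv_into S g (\<psi> x t)) x t)"
    and u_solution: "eq_on X T
           (\<lambda>x t. Ot u x t - A t * Nx (\<lambda>x t. u x t * L u x t) x t)
           (\<lambda>x t. Nx (Mx u) x t + A t * u x t)"
    and \<psi>_Ot: "eq_on X T (Ot \<psi>) (\<lambda>x t. \<psi> x t * Ot (\<lambda>x t. A t * Ninv u x t) x t)"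
    and \<psi>_Nx: "eq_on X T (Nx \<psi>) (\<lambda>x t. \<psi> x t * Nx (\<lambda>x t. A t * Ninv u x t) x t)"
    and \<psi>_Mx: "eq_on X T (Mx \<psi>) (\<lambda>x t. \<psi> x t * Mx (\<lambda>x t. A t * Ninv u x t) x t)"
  shows "eq_on X T (Ot \<psi>) (Mx (Nx \<psi>)) \<and>
         eq_on X T \<psi> (\<lambda>x t. g (A t * Ninv u x t))"
proof -
  note F = \<open>function_algebra F\<close>
  note Ot = \<open>linear_op X T F F Ot\<close> \<open>acts_on_t X T F Ot\<close> \<open>differential_op_t X T F Ot\<close>
  note Nx = \<open>linear_op X T F F Nx\<close> \<open>acts_on_x X T F Nx\<close>
  note Mx = \<open>linear_op X T F F Mx\<close> \<open>acts_on_x X T F Mx\<close>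
  note L = \<open>linear_op X T F F L\<close> \<open>acts_on_x X T F L\<close>
  note Fmult = function_algebra_mult[OF F]
  have Fs: "function_space F"
    using F unfolding function_algebra_def by blast
  have OpF: "Ot v \<in> F" "Nx v \<in> F" "Mx v \<in> F" "L v \<in> F" if "v \<in> F" for v
    using Ot(1) Nx(1) Mx(1) L(1) that unfolding linear_op_def by blast+
  have AF: "(\<lambda>x t. A t * v x t) \<in> F" if "v \<in> F" for v
    using Fmult[OF A_regular that] .

  define \<phi> where "\<phi> = (\<lambda>x t. inv_into S g (\<psi> x t))"
  define \<theta> where "\<theta> = Ninv u"
  define w where "w = (\<lambda>x t. A t * \<theta> x t)"
  have \<phi>V: "\<phi> \<in> V" using \<psi>(3) by (simp add: \<phi>_def)
  have \<theta>V: "\<theta> \<in> V"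
    using Ninv u(1) unfolding \<theta>_def inverse_op_x_def linear_op_def by blast
  have wV: "w \<in> V" using V(4) \<theta>V by (simp add: w_def)
  have \<phi>F: "\<phi> \<in> F" and \<theta>F: "\<theta> \<in> F" and wF: "w \<in> F" and uF: "u \<in> F"
    using \<phi>V \<theta>V wV u(1) V(1) W(1) by auto
  have N\<theta>: "Nx \<theta> x t = u x t" if "x \<in> X" "t \<in> T" for x t
    using Ninv u(1) that unfolding \<theta>_def inverse_op_x_def eq_on_def by blast
  have Nw: "Nx w x t = A t * u x t" if "x \<in> X" "t \<in> T" for x t
    using linear_op_x_mult_t[OF Nx Fs \<theta>F AF[OF \<theta>F] that] N\<theta>[OF that] by (simp add: w_def)

  have off: "\<phi> x t = w x t" if x: "x \<in> X" and t: "t \<in> T" "t \<noteq> 0" for x t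
  proof (rule inverse_op_x_cancel[OF Ninv \<phi>V wV t(1) x])
    fix y assume y: "y \<in> X"
    have "u y t = 1 / A t * Nx \<phi> y t"
      using u_eq y t unfolding eq_on_def \<phi>_def by blast
    then show "Nx \<phi> y t = Nx w y t"
      using iv(2) t Nw[OF y t(1)] by simp
  qed
  have \<phi>w: "\<phi> x t = w x t" if x: "x \<in> X" and t: "t \<in> T" for x t
  proof (cases "t = 0")
    case True
    \<comment> \<open>At a second time \<open>s \<noteq> 0\<close> one has
      \<open>Ot A = -A\<^sup>2 \<noteq> 0\<close>. So \<open>A\<close> witnesses that
      \<open>Ot\<close> is not the zero operator, which yields continuity in \<open>t\<close> for
      all functions in \<open>F\<close>.\<close>
    have "T \<noteq> {0}" using \<open>open T\<close> not_open_singleton by metis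
    then obtain s where s: "s \<in> T" "s \<noteq> 0" using t True by blast
    have "Ot (\<lambda>x t. A t) x s \<noteq> 0"
      using eq_onD[OF iv(1) x s(1)] iv(2) s by simp
    then have cont: "isCont (v x) t" if "v \<in> F" for v
      using leibniz_differential_op_t_differentiable[OF Ot(3) i(1) A_regular
          AF[OF A_regular] x s(1) _ that x t]
      by (metis differentiable_imp_continuous_within)
    show ?thesis
      by (rule continuous_eq_at_point[OF cont[OF \<phi>F] cont[OF wF] \<open>open T\<close> t])
        (use off[OF x] True in blast)
  qed (use off x t in blast)

  have evolution: "Ot \<theta> x t - A t * \<theta> x t = A t * (u x t * L u x t) + Mx u x t"
    if x: "x \<in> X" and t: "t \<in> T" for x t
  proof -
    have lhsV: "(\<lambda>x t. Ot \<theta> x t - w x t) \<in> V"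
      using V(3) \<theta>V wV function_space_diff[OF V(2)] by blast
    have uLuF: "(\<lambda>x t. u x t * L u x t) \<in> F"
      using Fmult uF OpF(4) by blast
    have "(\<lambda>x t. Ot \<theta> x t - w x t) x t = (\<lambda>x t. A t * (u x t * L u x t) + Mx u x t) x t"
    proof (rule inverse_op_x_cancel[OF Ninv lhsV u(2) t x])
      fix y assume y: "y \<in> X"
      have "Nx (\<lambda>x t. Ot \<theta> x t - w x t) y t = Nx (Ot \<theta>) y t - A t * u y t"
        using linear_op_diff[OF Nx(1) OpF(1)[OF \<theta>F] wF y t] Nw[OF y t] by simp
      also have "Nx (Ot \<theta>) y t = Ot (Nx \<theta>) y t"
        using ii(2) \<theta>F y t unfolding eq_on_def commutator_def by fastforce
      \<comment> \<open>\<open>Nx \<theta>\<close> and \<open>u\<close> agree only on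
        \<open>X \<times> T\<close>; as \<open>Ot\<close> acts only on \<open>t\<close>, agreement
        on the time slice at \<open>y\<close> is enough.\<close>
      also have "\<dots> = Ot u y t"
        using acts_on_t_cong[OF Ot(2) OpF(2)[OF \<theta>F] uF t y] N\<theta> y by blast
      also have "Ot u y t - A t * u y t
          = A t * Nx (\<lambda>x t. u x t * L u x t) y t + Nx (Mx u) y t"
        using eq_onD[OF u_solution y t] by simp
      \<comment> \<open>The factor \<open>A t\<close> depends on time alone and moves inside
        \<open>Nx\<close>; now both sides are values of \<open>Nx\<close> at elements of
        \<open>V\<close>.\<close>
      also have "\<dots> = Nx (\<lambda>x t. A t * (u x t * L u x t) + Mx u x t) y t"
        using linear_op_add[OF Nx(1) AF[OF uLuF] OpF(3)[OF uF] y t]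
          linear_op_x_mult_t[OF Nx Fs uLuF AF[OF uLuF] y t] by simp
      finally show "Nx (\<lambda>x t. Ot \<theta> x t - w x t) y t
          = Nx (\<lambda>x t. A t * (u x t * L u x t) + Mx u x t) y t" .
    qed
    then show ?thesis by (simp add: w_def)
  qed

  have "Ot \<psi> x t = Mx (Nx \<psi>) x t" if x: "x \<in> X" and t: "t \<in> T" for x t
  proof -
    \<comment> \<open>Leibniz for \<open>A * \<theta>\<close> with \<open>Ot A = -A\<^sup>2\<close>:
      the quadratic term supplies exactly the \<open>- A * \<theta>\<close> occurring in
      \<open>evolution\<close>.\<close>
    have "Ot w x t = A t * (Ot \<theta> x t - A t * \<theta> x t)"
      using leibnizD[OF i(1) A_regular \<theta>F x t] eq_onD[OF iv(1) x t]
      by (simp add: w_def algebra_simps power2_eq_square)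
    then have lhs: "Ot \<psi> x t = \<psi> x t * (A t * (A t * (u x t * L u x t) + Mx u x t))"
      using eq_onD[OF \<psi>_Ot x t] evolution[OF x t] by (simp add: w_def \<theta>_def)

    \<comment> \<open>The factorisation of \<open>Mx\<close> through \<open>Nx\<close> turns
      \<open>Mx \<theta>\<close> into \<open>L u\<close>, the source of the nonlinear term
      \<open>u * L u\<close>.\<close>
    have "Mx \<theta> x t = L (Nx \<theta>) x t"
      using iii \<theta>F x t unfolding eq_on_def by blast
    also have "\<dots> = L u x t"
      using acts_on_x_cong[OF L(2) OpF(2)[OF \<theta>F] uF t x] N\<theta> t by blast
    finally have "Mx w x t = A t * L u x t"
      using linear_op_x_mult_t[OF Mx Fs \<theta>F AF[OF \<theta>F] x t] by (simp add: w_def)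
    then have M\<psi>: "Mx \<psi> x t = \<psi> x t * (A t * L u x t)"
      using eq_onD[OF \<psi>_Mx x t] by (simp add: w_def \<theta>_def)
    have N\<psi>: "Nx \<psi> y t = \<psi> y t * (A t * u y t)" if "y \<in> X" for y
      using eq_onD[OF \<psi>_Nx that t] Nw[OF that t] by (simp add: w_def \<theta>_def)
    \<comment> \<open>\<open>Mx\<close> depends on the whole slice at time \<open>t\<close>, so the
      formula for \<open>Nx \<psi>\<close> is needed at every \<open>y\<close> in \<open>X\<close>,
      not only at \<open>x\<close>.\<close>
    have "Mx (Nx \<psi>) x t = Mx (\<lambda>x t. \<psi> x t * (A t * u x t)) x t"
      using N\<psi> by (intro acts_on_x_cong[OF Mx(2) OpF(2)[OF \<psi>(1)] Fmult[OF \<psi>(1) AF[OF uF]] t x])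
    also have "\<dots> = \<psi> x t * (A t * Mx u x t) + A t * u x t * Mx \<psi> x t"
      using leibnizD[OF i(3) \<psi>(1) AF[OF uF] x t]
        linear_op_x_mult_t[OF Mx Fs uF AF[OF uF] x t] by simp
    finally show ?thesis
      by (simp add: lhs M\<psi> algebra_simps)
  qed
  moreover have "\<psi> x t = g (A t * Ninv u x t)" if x: "x \<in> X" and t: "t \<in> T" for x t
  proof -
    have "\<psi> x t \<in> g ` S"
      using g \<psi>(2) x t by (simp add: bij_betw_def)
    then have "\<psi> x t = g (\<phi> x t)"
      by (simp add: \<phi>_def f_inv_into_f)
    then show ?thesis
      using \<phi>w[OF x t] by (simp add: w_def \<theta>_def)
  qed
  ultimately show ?thesis
    by (simp add: eq_on_def)
qed

end
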